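(* Let $\approx$ be an equinumerosity on the family $\mathbf F$ of point sets over $\mathbb N$, let $\mathfrak N=\mathbf F/\!\approx$ be its set of numerosities and $\mathfrak n:\mathbf F\to\mathfrak N$ the canonical map. Then there exist unique operations $+$ and $\cdot$ and a unique linear order $<$ on $\mathfrak N$ such that for all point sets $A,B$: (1) $\mathfrak n(A)+\mathfrak n(B)=\mathfrak n(A\cup B)$ whenever $A,B\subseteq\mathbb N^k$ for the same $k$ and $A\cap B=\emptyset$; (2) $\mathfrak n(A)\cdot\mathfrak n(B)=\mathfrak n(A\times B)$; (3) $\mathfrak n(A)<\mathfrak n(B)$ iff $A\approx B'$ for some proper subset $B'\subset B$. The resulting structure on $\mathfrak N$ is the non-negative part of a discretely ordered (not necessarily commutative) ring $(\mathfrak R,0,1,+,\cdot,<)$. Moreover, if the fundamental subring of $\mathfrak R$ is identified with $\mathbb Z$, then $\mathfrak n(A)=|A|$ for every finite point set $A$.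
   Context: $\mathbb N=\{0,1,2,\dots\}$. $\mathbf F=\bigcup_{k\ge1}\mathcal P(\mathbb N^k)$ is the family of point sets. Cartesian products are identified with concatenations: for $A\subseteq\mathbb N^k$, $B\subseteq\mathbb N^h$, $A\times B=\{(a_1,\dots,a_k,b_1,\dots,b_h): (a_1,\dots,a_k)\in A,(b_1,\dots,b_h)\in B\}\subseteq\mathbb N^{k+h}$. An equinumerosity is an equivalence relation $\approx$ on $\mathbf F$ such that for all point sets $A,B,A',B'$: (E1) $A\approx B$ iff $A\setminus B\approx B\setminus A$; (E2) exactly one of: (a) $A\approx B$; (b) $A'\approx B$ for some proper subset $A'\subset A$; (c) $A\approx B'$ for some proper subset $B'\subset B$; (E3) $A\times\{P\}\approx\{P\}\times A\approx A$ for every point $P$ (element of some $\mathbb N^h$); (E4) $A\approx A'$ and $B\approx B'$ imply $A\times B\approx A'\times B'$. *)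

theory Defs
  imports "HOL-Algebra.Algebra"
begin

(* A point (a_1, ..., a_k) of N^k is the list [a_1, ..., a_k], so that the identification of
   Cartesian products with concatenations is literal, and the empty set is a single point set
   belonging to every dimension. *)

definition points :: "nat list set" where
  "points = {p. length p \<ge> 1}"

definition space_of_dim :: "nat \<Rightarrow> nat list set" where
  "space_of_dim k = {p. length p = k}"

definition pointsets :: "nat list set set" where
  "pointsets = (\<Union>k\<in>{1..}. Pow (space_of_dim k))"

definition pointset_prod :: "nat list set \<Rightarrow> nat list set \<Rightarrow> nat list set"
    (infixr \<open>\<times>\<^sub>p\<close> 75) where
  "A \<times>\<^sub>p B = {p @ q | p q. p \<in> A \<and> q \<in> B}"

locale equinumerosity =
  fixes E :: "(nat list set \<times> nat list set) set"
  assumes equiv: "equiv pointsets E"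
    and E1: "\<lbrakk>A \<in> pointsets; B \<in> pointsets\<rbrakk> \<Longrightarrow> (A, B) \<in> E \<longleftrightarrow> (A - B, B - A) \<in> E"
    and E2_some: "\<lbrakk>A \<in> pointsets; B \<in> pointsets\<rbrakk> \<Longrightarrow>
          (A, B) \<in> E \<or> (\<exists>A'. A' \<subset> A \<and> (A', B) \<in> E) \<or> (\<exists>B'. B' \<subset> B \<and> (A, B') \<in> E)"
    and E2_not_ab: "\<lbrakk>A \<in> pointsets; B \<in> pointsets\<rbrakk> \<Longrightarrow>
          \<not> ((A, B) \<in> E \<and> (\<exists>A'. A' \<subset> A \<and> (A', B) \<in> E))"
    and E2_not_ac: "\<lbrakk>A \<in> pointsets; B \<in> pointsets\<rbrakk> \<Longrightarrow>
          \<not> ((A, B) \<in> E \<and> (\<exists>B'. B' \<subset> B \<and> (A, B') \<in> E))"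
    and E2_not_bc: "\<lbrakk>A \<in> pointsets; B \<in> pointsets\<rbrakk> \<Longrightarrow>
          \<not> ((\<exists>A'. A' \<subset> A \<and> (A', B) \<in> E) \<and> (\<exists>B'. B' \<subset> B \<and> (A, B') \<in> E))"
    and E3: "\<lbrakk>A \<in> pointsets; P \<in> points\<rbrakk> \<Longrightarrow> (A \<times>\<^sub>p {P}, {P} \<times>\<^sub>p A) \<in> E \<and> ({P} \<times>\<^sub>p A, A) \<in> E"
    and E4: "\<lbrakk>(A, A') \<in> E; (B, B') \<in> E\<rbrakk> \<Longrightarrow> (A \<times>\<^sub>p B, A' \<times>\<^sub>p B') \<in> E"

definition numerosities :: "(nat list set \<times> nat list set) set \<Rightarrow> nat list set set set" where
  "numerosities E = pointsets // E"

definition numerosity ::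
    "(nat list set \<times> nat list set) set \<Rightarrow> nat list set \<Rightarrow> nat list set set" where
  "numerosity E A = E `` {A}"

(* Operations on the numerosities are extensional functions and the order is a set of pairs of
   numerosities, so that their uniqueness can be expressed by equality. *)

definition numerosity_sum ::
    "(nat list set \<times> nat list set) set \<Rightarrow>
      (nat list set set \<Rightarrow> nat list set set \<Rightarrow> nat list set set) \<Rightarrow> bool" where
  "numerosity_sum E plusN \<longleftrightarrow>
     plusN \<in> numerosities E \<rightarrow>\<^sub>E (numerosities E \<rightarrow>\<^sub>E numerosities E) \<and>
     (\<forall>k\<ge>1. \<forall>A B. A \<subseteq> space_of_dim k \<longrightarrow> B \<subseteq> space_of_dim k \<longrightarrow> A \<inter> B = {} \<longrightarrow>
        plusN (numerosity E A) (numerosity E B) = numerosity E (A \<union> B))"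

definition numerosity_product ::
    "(nat list set \<times> nat list set) set \<Rightarrow>
      (nat list set set \<Rightarrow> nat list set set \<Rightarrow> nat list set set) \<Rightarrow> bool" where
  "numerosity_product E timesN \<longleftrightarrow>
     timesN \<in> numerosities E \<rightarrow>\<^sub>E (numerosities E \<rightarrow>\<^sub>E numerosities E) \<and>
     (\<forall>A\<in>pointsets. \<forall>B\<in>pointsets.
        timesN (numerosity E A) (numerosity E B) = numerosity E (A \<times>\<^sub>p B))"

definition numerosity_order ::
    "(nat list set \<times> nat list set) set \<Rightarrow> (nat list set set \<times> nat list set set) set \<Rightarrow> bool" where
  "numerosity_order E lessN \<longleftrightarrow>
     lessN \<subseteq> numerosities E \<times> numerosities E \<and>
     strict_linear_order_on (numerosities E) lessN \<and>
     (\<forall>A\<in>pointsets. \<forall>B\<in>pointsets.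
        (numerosity E A, numerosity E B) \<in> lessN \<longleftrightarrow> (\<exists>B'. B' \<subset> B \<and> (A, B') \<in> E))"

locale discretely_ordered_ring = ring R for R (structure) +
  fixes lt :: "('a \<times> 'a) set"
  assumes lt_carrier: "lt \<subseteq> carrier R \<times> carrier R"
    and lt_linear: "strict_linear_order_on (carrier R) lt"
    and lt_add: "\<lbrakk>(x, y) \<in> lt; z \<in> carrier R\<rbrakk> \<Longrightarrow> (x \<oplus> z, y \<oplus> z) \<in> lt"
    and lt_mult: "\<lbrakk>(\<zero>, x) \<in> lt; (\<zero>, y) \<in> lt\<rbrakk> \<Longrightarrow> (\<zero>, x \<otimes> y) \<in> lt"
    and zero_lt_one: "(\<zero>, \<one>) \<in> lt"
    and discrete: "\<not> (\<exists>x. (\<zero>, x) \<in> lt \<and> (x, \<one>) \<in> lt)"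

definition nonneg_part :: "('a, 'm) ring_scheme \<Rightarrow> ('a \<times> 'a) set \<Rightarrow> 'a set" where
  "nonneg_part R lt = {x \<in> carrier R. x = \<zero>\<^bsub>R\<^esub> \<or> (\<zero>\<^bsub>R\<^esub>, x) \<in> lt}"

(* N is a literal subset of the carrier. For numerosities, the ring therefore has carrier type
   nat list set set; elements of that type that are not equivalence classes, such as
   insert {[]} x for a class x, are available for the negatives. *)

definition is_nonneg_part ::
    "'a set \<Rightarrow> ('a \<Rightarrow> 'a \<Rightarrow> 'a) \<Rightarrow> ('a \<Rightarrow> 'a \<Rightarrow> 'a) \<Rightarrow> ('a \<times> 'a) set \<Rightarrow>
      ('a, 'm) ring_scheme \<Rightarrow> ('a \<times> 'a) set \<Rightarrow> bool" where
  "is_nonneg_part N plusN timesN lessN R lt \<longleftrightarrow>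
     N = nonneg_part R lt \<and>
     (\<forall>x\<in>N. \<forall>y\<in>N. plusN x y = x \<oplus>\<^bsub>R\<^esub> y \<and> timesN x y = x \<otimes>\<^bsub>R\<^esub> y \<and>
        ((x, y) \<in> lessN \<longleftrightarrow> (x, y) \<in> lt))"

abbreviation fundamental_subring :: "('a, 'm) ring_scheme \<Rightarrow> ('a, 'm) ring_scheme" where
  "fundamental_subring R \<equiv> R\<lparr>carrier := generate_ring R {}\<rparr>"

end

(* E1 makes disjoint unions in a fixed dimension compatible with equinumerosity and cancellable;
   prefixing by points (E3) carries any two point sets to disjoint copies in one dimension, so
   the sum is total and well defined. By trichotomy (E2), x < y holds exactly when y = x + z
   for some nonzero z. Hence the numerosities form a cancellative semiring in which any two
   elements have a difference in one direction, and formal differences give the ordered ring. *)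

theory Submission
  imports Defs
begin

text \<open>E1 is trivial for sets of different dimensions, since these are disjoint already; it
  gives information only once sets have been moved into one dimension by steps that preserve their
  classes. The order meets a different obstacle: equinumerosity of \<open>B\<close> and
  \<open>C\<close> supplies no map along which a proper part of \<open>B\<close> could be carried to
  \<open>C\<close>, so the exclusivity in E2 has to do that work. The ring has to contain the
  numerosities themselves and not copies of them. Since a difference exists in one direction, every
  formal difference has a normal form, either a numerosity or a tagged nonzero numerosity, and these
  normal forms take the place of classes of pairs. Discreteness comes from the fact that a singleton
  has no proper subset except the empty set, and positivity of products from the fact that nonempty
  sets have a nonempty product. Multiplication need not commute, so factors keep their order
  throughout.\<close>

section \<open>Ordered rings\<close>

text \<open>An order compatible with addition is determined by its positive elements, so all order
  axioms become conditions on the cone \<open>P\<close>. Discreteness turns into the condition that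
  \<open>x\<close> and \<open>\<one> \<ominus> x\<close> are never both positive. The cone used
  below consists of the nonzero elements of a semiring.\<close>

lemma (in ring) discretely_ordered_ring_of_cone:
  assumes P: "P \<subseteq> carrier R" and zero: "\<zero> \<notin> P" and one: "\<one> \<in> P"
    and add: "\<And>x y. \<lbrakk>x \<in> P; y \<in> P\<rbrakk> \<Longrightarrow> x \<oplus> y \<in> P"
    and mult: "\<And>x y. \<lbrakk>x \<in> P; y \<in> P\<rbrakk> \<Longrightarrow> x \<otimes> y \<in> P"
    and total: "\<And>x. x \<in> carrier R \<Longrightarrow> x = \<zero> \<or> x \<in> P \<or> \<ominus> x \<in> P"
    and discrete: "\<And>x. \<lbrakk>x \<in> P; \<one> \<ominus> x \<in> P\<rbrakk> \<Longrightarrow> False"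
  shows "discretely_ordered_ring R {(x, y). x \<in> carrier R \<and> y \<in> carrier R \<and> y \<ominus> x \<in> P}"
    (is "discretely_ordered_ring R ?lt")
proof (unfold_locales)
  have "z \<ominus> x = (z \<ominus> y) \<oplus> (y \<ominus> x)"
    if "x \<in> carrier R" "y \<in> carrier R" "z \<in> carrier R" for x y z
    using that by algebra
  then have "trans ?lt"
    by (intro transI) (simp, metis add)
  moreover have "irrefl ?lt"
    using zero by (auto simp: irrefl_def a_minus_def r_neg)
  moreover have "total_on (carrier R) ?lt"
  proof (rule total_onI)
    fix x y assume xy: "x \<in> carrier R" "y \<in> carrier R" "x \<noteq> y"
    then have "\<ominus> (y \<ominus> x) = x \<ominus> y" "y \<ominus> x \<noteq> \<zero>"
      by (algebra, simp)
    then show "(x, y) \<in> ?lt \<or> (y, x) \<in> ?lt"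
      using total[of "y \<ominus> x"] xy by simp
  qed
  ultimately show "strict_linear_order_on (carrier R) ?lt"
    by (simp add: strict_linear_order_on_def)
next
  fix x y z assume "(x, y) \<in> ?lt" "z \<in> carrier R"
  moreover from this have "(y \<oplus> z) \<ominus> (x \<oplus> z) = y \<ominus> x"
    by (simp) algebra
  ultimately show "(x \<oplus> z, y \<oplus> z) \<in> ?lt"
    by simp
next
  have sub_zero: "x \<ominus> \<zero> = x" if "x \<in> carrier R" for x
    using that by algebra
  show "(\<zero>, x \<otimes> y) \<in> ?lt" if "(\<zero>, x) \<in> ?lt" "(\<zero>, y) \<in> ?lt" for x y
    using that by (auto simp: sub_zero mult)
  show "(\<zero>, \<one>) \<in> ?lt"
    by (simp add: sub_zero one)
  show "\<not> (\<exists>x. (\<zero>, x) \<in> ?lt \<and> (x, \<one>) \<in> ?lt)"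
    using discrete sub_zero by auto
qed auto

section \<open>Integer multiples of one and the fundamental subring\<close>

context discretely_ordered_ring
begin

lemma nat_multiple_one_pos: "(\<zero>, [Suc n] \<cdot> \<one>) \<in> lt"
proof (induction n)
  case 0
  then show ?case by (simp add: zero_lt_one)
next
  case (Suc n)
  have "(\<zero> \<oplus> \<one>, [Suc n] \<cdot> \<one> \<oplus> \<one>) \<in> lt"
    using Suc by (rule lt_add) simp
  then have "(\<one>, [Suc (Suc n)] \<cdot> \<one>) \<in> lt"
    by simp
  with zero_lt_one show ?case
    using lt_linear unfolding strict_linear_order_on_def by (meson transD)
qed

text \<open>The order forces characteristic zero: positive multiples of \<open>\<one>\<close> are
  strictly above \<open>\<zero>\<close>, and negative multiples are their additive inverses.\<close>

lemma int_multiple_one_eq_zero: "[(k::int)] \<cdot> \<one> = \<zero> \<longleftrightarrow> k = 0"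
proof -
  have "[int (Suc n)] \<cdot> \<one> \<noteq> \<zero>" for n
    using nat_multiple_one_pos[of n] lt_linear
    by (auto simp: add_pow_int_ge strict_linear_order_on_def irrefl_def simp del: of_nat_Suc)
  moreover have "[(- k)] \<cdot> \<one> = \<ominus> ([k] \<cdot> \<one>)"
    by (rule add.int_pow_neg) simp
  ultimately show ?thesis
    by (cases k rule: int_cases3) (auto simp: gr0_conv_Suc add_pow_int_ge[of 0] simp del: of_nat_Suc)
qed

text \<open>The multiples of \<open>\<one>\<close> contain \<open>\<one>\<close> and are closed
  under the ring operations, so they exhaust the subring generated by the empty set; characteristic
  zero makes the map injective. This map is the identification of the fundamental subring with the
  integers.\<close>

lemma int_multiple_one_ring_iso:
  "(\<lambda>k::int. [k] \<cdot> \<one>) \<in> ring_iso \<Z> (fundamental_subring R)"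
proof -
  let ?f = "\<lambda>k::int. [k] \<cdot> \<one>"
  have add: "?f (k + l) = ?f k \<oplus> ?f l" for k l
    by (rule add.int_pow_mult[symmetric, THEN sym]) simp
  have neg: "?f (- k) = \<ominus> (?f k)" for k
    by (rule add.int_pow_neg) simp
  have mult: "?f (k * l) = ?f k \<otimes> ?f l" for k l
    by (simp add: add_pow_ldistr_int add.int_pow_pow mult.commute)
  have one: "?f 1 = \<one>"
    by (simp add: add.int_pow_1)
  have "[(n::nat)] \<cdot> \<one> \<in> generate_ring R {}" for n
    by (induction n) (auto intro: generate_ring.intros zero_in_generate)
  then have mem: "?f k \<in> generate_ring R {}" for k
    by (cases "k < 0") (auto simp: add_pow_int_ge add_pow_int_lt intro: generate_ring.a_inv)
  have "h \<in> range ?f" if "h \<in> generate_ring R {}" for h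
    using that
  proof (induction rule: generate_ring.induct)
    case one
    then show ?case using \<open>?f 1 = \<one>\<close> by (metis rangeI)
  qed (auto simp: add[symmetric] neg[symmetric] mult[symmetric])
  moreover have "inj ?f"
  proof (rule injI)
    fix k l assume eq: "?f k = ?f l"
    have "?f (k + - l) = \<zero>"
      unfolding add neg using eq by (simp add: r_neg)
    then show "k = l"
      using int_multiple_one_eq_zero by fastforce
  qed
  ultimately have "bij_betw ?f UNIV (generate_ring R {})"
    using mem by (auto simp: bij_betw_def)
  then show ?thesis
    by (auto simp: ring_iso_def ring_hom_def add mult one mem)
qed

end

section \<open>Rings of differences\<close>

(* The map negate supplies names for the negatives, so that the ring of differences can be
   built on the type of the semiring, with the semiring itself as a subset of its carrier. *)

locale difference_semiring = semiring S for S (structure) +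
  fixes negate :: "'a \<Rightarrow> 'a"
  assumes add_cancel:
      "\<lbrakk>x \<in> carrier S; y \<in> carrier S; z \<in> carrier S; x \<oplus> z = y \<oplus> z\<rbrakk> \<Longrightarrow> x = y"
    and add_eq_zeroD: "\<lbrakk>x \<in> carrier S; y \<in> carrier S; x \<oplus> y = \<zero>\<rbrakk> \<Longrightarrow> x = \<zero>"
    and add_total:
      "\<lbrakk>x \<in> carrier S; y \<in> carrier S\<rbrakk> \<Longrightarrow> \<exists>z\<in>carrier S. x \<oplus> z = y \<or> y \<oplus> z = x"
    and mult_eq_zeroD:
      "\<lbrakk>x \<in> carrier S; y \<in> carrier S; x \<otimes> y = \<zero>\<rbrakk> \<Longrightarrow> x = \<zero> \<or> y = \<zero>"
    and add_eq_oneD: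
      "\<lbrakk>x \<in> carrier S; y \<in> carrier S; x \<oplus> y = \<one>\<rbrakk> \<Longrightarrow> x = \<zero> \<or> y = \<zero>"
    and one_neq_zero: "\<one> \<noteq> \<zero>"
    and negate_inj: "inj_on negate (carrier S)"
    and negate_fresh: "x \<in> carrier S \<Longrightarrow> negate x \<notin> carrier S"
begin

section \<open>Normal forms of formal differences\<close>

lemma add_cancel_iff:
  assumes "x \<in> carrier S" "y \<in> carrier S" "z \<in> carrier S"
  shows "x \<oplus> z = y \<oplus> z \<longleftrightarrow> x = y" "z \<oplus> x = z \<oplus> y \<longleftrightarrow> x = y"
  using assms add_cancel a_comm by metis+

text \<open>The normal form of \<open>a\<close> minus \<open>b\<close>. The case of equal arguments
  falls under the first branch, so for arguments in the carrier only nonzero elements are ever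
  passed to \<open>negate\<close>, and zero has a single name.\<close>

definition diff :: "'a \<Rightarrow> 'a \<Rightarrow> 'a" where
  "diff a b = (if \<exists>c\<in>carrier S. a = b \<oplus> c then THE c. c \<in> carrier S \<and> a = b \<oplus> c
     else negate (THE c. c \<in> carrier S \<and> b = a \<oplus> c))"

lemma diff_add: "\<lbrakk>b \<in> carrier S; c \<in> carrier S\<rbrakk> \<Longrightarrow> diff (b \<oplus> c) b = c"
  unfolding diff_def by (auto simp: add_cancel_iff)

lemma diff_zero: "a \<in> carrier S \<Longrightarrow> diff a \<zero> = a"
  using diff_add[of \<zero> a] by simp

text \<open>A nonzero \<open>c\<close> rules out the first branch of \<open>diff\<close>: if
  \<open>a\<close> were \<open>a \<oplus> c \<oplus> d\<close>, cancellation would give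
  \<open>c \<oplus> d = \<zero>\<close> and hence \<open>c = \<zero>\<close>.\<close>

lemma diff_negate:
  assumes a: "a \<in> carrier S" and c: "c \<in> carrier S" "c \<noteq> \<zero>"
  shows "diff a (a \<oplus> c) = negate c"
proof -
  have "\<not> (\<exists>d\<in>carrier S. a = a \<oplus> c \<oplus> d)"
  proof
    assume "\<exists>d\<in>carrier S. a = a \<oplus> c \<oplus> d"
    then obtain d where d: "d \<in> carrier S" "a \<oplus> \<zero> = a \<oplus> (c \<oplus> d)"
      using a c by (auto simp: a_assoc)
    then have "c \<oplus> d = \<zero>"
      using a c by (simp only: add_cancel_iff a_closed zero_closed)
    with d c show False
      using add_eq_zeroD by blast
  qed
  moreover have "(THE d. d \<in> carrier S \<and> a \<oplus> c = a \<oplus> d) = c"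
    by (rule the_equality) (use a c in \<open>auto simp: add_cancel_iff\<close>)
  ultimately show ?thesis
    by (simp add: diff_def)
qed

lemma diff_cases:
  assumes "a \<in> carrier S" "b \<in> carrier S"
  obtains (nonneg) e where "e \<in> carrier S" "a = b \<oplus> e" "diff a b = e"
    | (neg) e where "e \<in> carrier S" "e \<noteq> \<zero>" "b = a \<oplus> e" "diff a b = negate e"
proof -
  obtain e where e: "e \<in> carrier S" "a \<oplus> e = b \<or> b \<oplus> e = a"
    using add_total[OF assms] by blast
  \<comment> \<open>Equality of \<open>a\<close> and \<open>b\<close> is assigned to the nonnegative
    case; this is what makes \<open>e\<close> nonzero in the other one.\<close>
  show thesis
  proof (cases "a = b \<or> b \<oplus> e = a")
    case True
    then show thesis
      using nonneg[of \<zero>] nonneg[of e] diff_add[of b e] diff_add[of b \<zero>] e assms by auto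
  next
    case False
    then have "e \<noteq> \<zero>" "b = a \<oplus> e"
      using e assms by auto
    then show thesis
      using neg[of e] diff_negate[of a e] e assms by auto
  qed
qed

text \<open>Normal forms thus behave like classes of pairs under the usual cross relation, and the
  ring laws reduce to identities in the semiring. When both differences have the same sign, a common
  summand cancels from the two cross sums.\<close>

lemma diff_eq_iff:
  assumes abcd: "a \<in> carrier S" "b \<in> carrier S" "c \<in> carrier S" "d \<in> carrier S"
  shows "diff a b = diff c d \<longleftrightarrow> a \<oplus> d = c \<oplus> b"
proof -
  \<comment> \<open>With opposite signs both sides of the equivalence fail: \<open>negate f\<close>
    lies outside the semiring while \<open>e\<close> lies inside, and the cross sums differ by
    \<open>f \<oplus> e\<close>, which is nonzero because \<open>f\<close> is.\<close>
  have mixed: "diff a b \<noteq> diff c d \<and> a \<oplus> d \<noteq> c \<oplus> b"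
    if abcd: "a \<in> carrier S" "b \<in> carrier S" "c \<in> carrier S" "d \<in> carrier S"
      and e: "e \<in> carrier S" "a = b \<oplus> e" "diff a b = e"
      and f: "f \<in> carrier S" "f \<noteq> \<zero>" "d = c \<oplus> f" "diff c d = negate f"
    for a b c d e f
  proof -
    have "a \<oplus> d = (b \<oplus> c) \<oplus> (f \<oplus> e)" "c \<oplus> b = (b \<oplus> c) \<oplus> \<zero>"
      using abcd e f by (simp_all add: a_ac)
    moreover have "f \<oplus> e \<noteq> \<zero>"
      using e f add_eq_zeroD by blast
    then have "(b \<oplus> c) \<oplus> (f \<oplus> e) \<noteq> (b \<oplus> c) \<oplus> \<zero>"
      using abcd e f by (simp only: add_cancel_iff a_closed zero_closed not_False_eq_True)
    ultimately have "a \<oplus> d \<noteq> c \<oplus> b"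
      by (simp only: not_False_eq_True)
    then show ?thesis
      using e f negate_fresh by metis
  qed
  from abcd(1,2) show ?thesis
  proof (cases rule: diff_cases)
    case e: (nonneg e)
    from abcd(3,4) show ?thesis
    proof (cases rule: diff_cases)
      case f: (nonneg f)
      have "a \<oplus> d = (b \<oplus> d) \<oplus> e" "c \<oplus> b = (b \<oplus> d) \<oplus> f"
        using abcd e f by (simp_all add: a_ac)
      then show ?thesis
        using abcd e f by (simp only: add_cancel_iff a_closed)
    next
      case f: (neg f)
      then show ?thesis
        using mixed[OF abcd e f] by blast
    qed
  next
    case e: (neg e)
    from abcd(3,4) show ?thesis
    proof (cases rule: diff_cases)
      case f: (nonneg f)
      then show ?thesis
        using mixed[OF abcd(3,4,1,2) f e] by metis
    next
      case f: (neg f)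
      have "a \<oplus> d = (a \<oplus> c) \<oplus> f" "c \<oplus> b = (a \<oplus> c) \<oplus> e"
        using abcd e f by (simp_all add: a_ac)
      moreover have "negate e = negate f \<longleftrightarrow> e = f"
        using negate_inj e f by (simp add: inj_on_eq_iff)
      ultimately show ?thesis
        using abcd e f by (auto simp only: add_cancel_iff a_closed)
    qed
  qed
qed

section \<open>Ring operations on differences\<close>

definition pos_part :: "'a \<Rightarrow> 'a" where
  "pos_part r = (SOME a. a \<in> carrier S \<and> (\<exists>b\<in>carrier S. diff a b = r))"

text \<open>The choice is made relative to \<open>pos_part r\<close>, so that the two parts
  represent \<open>r\<close> jointly; two independent choices need not.\<close>

definition neg_part :: "'a \<Rightarrow> 'a" where
  "neg_part r = (SOME b. b \<in> carrier S \<and> diff (pos_part r) b = r)"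

definition difference_ring :: "'a ring" where
  "difference_ring =
    \<lparr>carrier = {diff a b | a b. a \<in> carrier S \<and> b \<in> carrier S},
     monoid.mult = (\<lambda>r s. diff (pos_part r \<otimes> pos_part s \<oplus> neg_part r \<otimes> neg_part s)
       (pos_part r \<otimes> neg_part s \<oplus> neg_part r \<otimes> pos_part s)),
     one = \<one>, ring.zero = \<zero>,
     add = (\<lambda>r s. diff (pos_part r \<oplus> pos_part s) (neg_part r \<oplus> neg_part s))\<rparr>"

text \<open>The chosen pair for \<open>diff a b\<close> may differ from \<open>a\<close> and
  \<open>b\<close>. The cross equation is all that relates them, and it suffices to show that the
  operations do not depend on the choice.\<close>

lemma parts_diff:
  assumes "a \<in> carrier S" "b \<in> carrier S"
  shows "pos_part (diff a b) \<in> carrier S" "neg_part (diff a b) \<in> carrier S"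
    "a \<oplus> neg_part (diff a b) = pos_part (diff a b) \<oplus> b"
proof -
  let ?r = "diff a b"
  have "pos_part ?r \<in> carrier S \<and> (\<exists>b\<in>carrier S. diff (pos_part ?r) b = ?r)"
    unfolding pos_part_def by (rule someI_ex) (use assms in blast)
  then have p: "pos_part ?r \<in> carrier S" and n: "\<exists>b\<in>carrier S. diff (pos_part ?r) b = ?r"
    by auto
  have "neg_part ?r \<in> carrier S \<and> diff (pos_part ?r) (neg_part ?r) = ?r"
    unfolding neg_part_def[of ?r] by (rule someI_ex) (use n in blast)
  with p show "pos_part ?r \<in> carrier S" "neg_part ?r \<in> carrier S"
    "a \<oplus> neg_part ?r = pos_part ?r \<oplus> b"
    using diff_eq_iff[OF assms p, of "neg_part ?r"] by auto
qed

lemma difference_ring_add: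
  assumes "a \<in> carrier S" "b \<in> carrier S" "c \<in> carrier S" "d \<in> carrier S"
  shows "diff a b \<oplus>\<^bsub>difference_ring\<^esub> diff c d = diff (a \<oplus> c) (b \<oplus> d)"
proof -
  let ?p = "pos_part (diff a b)" and ?n = "neg_part (diff a b)"
  let ?p' = "pos_part (diff c d)" and ?n' = "neg_part (diff c d)"
  note parts = parts_diff[OF assms(1,2)] parts_diff[OF assms(3,4)]
  have "(?p \<oplus> ?p') \<oplus> (b \<oplus> d) = (?p \<oplus> b) \<oplus> (?p' \<oplus> d)"
    using assms parts(1,2,4,5) by (simp add: a_ac)
  also have "\<dots> = (a \<oplus> c) \<oplus> (?n \<oplus> ?n')"
    unfolding parts(3,6)[symmetric] using assms parts(1,2,4,5) by (simp add: a_ac)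
  finally show ?thesis
    using assms parts by (simp add: difference_ring_def diff_eq_iff)
qed

text \<open>Representatives are exchanged one factor at a time, the left factor first. Each exchange
  then uses a single cross equation, multiplied on one side by fixed elements, and needs no
  commutativity of multiplication.\<close>

lemma difference_ring_mult:
  assumes "a \<in> carrier S" "b \<in> carrier S" "c \<in> carrier S" "d \<in> carrier S"
  shows "diff a b \<otimes>\<^bsub>difference_ring\<^esub> diff c d = diff (a \<otimes> c \<oplus> b \<otimes> d) (a \<otimes> d \<oplus> b \<otimes> c)"
proof -
  let ?p = "pos_part (diff a b)" and ?n = "neg_part (diff a b)"
  let ?p' = "pos_part (diff c d)" and ?n' = "neg_part (diff c d)"
  note parts = parts_diff[OF assms(1,2)] parts_diff[OF assms(3,4)]
  note closed = assms parts(1,2,4,5)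
  have "diff (?p \<otimes> ?p' \<oplus> ?n \<otimes> ?n') (?p \<otimes> ?n' \<oplus> ?n \<otimes> ?p') =
      diff (a \<otimes> ?p' \<oplus> b \<otimes> ?n') (a \<otimes> ?n' \<oplus> b \<otimes> ?p')"
  proof -
    have "(?p \<otimes> ?p' \<oplus> ?n \<otimes> ?n') \<oplus> (a \<otimes> ?n' \<oplus> b \<otimes> ?p') = (?p \<oplus> b) \<otimes> ?p' \<oplus> (a \<oplus> ?n) \<otimes> ?n'"
      using closed by (simp add: l_distr a_ac)
    also have "\<dots> = (a \<oplus> ?n) \<otimes> ?p' \<oplus> (?p \<oplus> b) \<otimes> ?n'"
      by (simp only: parts(3))
    also have "\<dots> = (a \<otimes> ?p' \<oplus> b \<otimes> ?n') \<oplus> (?p \<otimes> ?n' \<oplus> ?n \<otimes> ?p')"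
      using closed by (simp add: l_distr a_ac)
    finally show ?thesis
      using closed by (simp add: diff_eq_iff)
  qed
  also have "\<dots> = diff (a \<otimes> c \<oplus> b \<otimes> d) (a \<otimes> d \<oplus> b \<otimes> c)"
  proof -
    have "(a \<otimes> ?p' \<oplus> b \<otimes> ?n') \<oplus> (a \<otimes> d \<oplus> b \<otimes> c) = a \<otimes> (?p' \<oplus> d) \<oplus> b \<otimes> (c \<oplus> ?n')"
      using closed by (simp add: r_distr a_ac)
    also have "\<dots> = a \<otimes> (c \<oplus> ?n') \<oplus> b \<otimes> (?p' \<oplus> d)"
      by (simp only: parts(6))
    also have "\<dots> = (a \<otimes> c \<oplus> b \<otimes> d) \<oplus> (a \<otimes> ?n' \<oplus> b \<otimes> ?p')"
      using closed by (simp add: r_distr a_ac)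
    finally show ?thesis
      using closed by (simp add: diff_eq_iff)
  qed
  finally show ?thesis
    by (simp add: difference_ring_def)
qed

lemma difference_ring_carrierE:
  assumes "r \<in> carrier difference_ring"
  obtains a b where "a \<in> carrier S" "b \<in> carrier S" "r = diff a b"
  using assms by (auto simp: difference_ring_def)

lemma diff_in_difference_ring:
  "\<lbrakk>a \<in> carrier S; b \<in> carrier S\<rbrakk> \<Longrightarrow> diff a b \<in> carrier difference_ring"
  by (auto simp: difference_ring_def)

lemma difference_ring_zero: "\<zero>\<^bsub>difference_ring\<^esub> = diff \<zero> \<zero>"
  by (simp add: difference_ring_def diff_zero)

lemma difference_ring_one: "\<one>\<^bsub>difference_ring\<^esub> = diff \<one> \<zero>"
  by (simp add: difference_ring_def diff_zero)

lemmas difference_ring_simps =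
  difference_ring_zero difference_ring_one difference_ring_add difference_ring_mult

lemma ring_difference_ring: "ring difference_ring"
proof (rule ringI)
  show "abelian_group difference_ring"
  proof (rule abelian_groupI)
    fix x assume "x \<in> carrier difference_ring"
    then obtain a b where ab: "a \<in> carrier S" "b \<in> carrier S" "x = diff a b"
      by (rule difference_ring_carrierE)
    have "diff b a \<oplus>\<^bsub>difference_ring\<^esub> x = \<zero>\<^bsub>difference_ring\<^esub>"
      using ab by (simp add: difference_ring_simps diff_eq_iff a_ac)
    with ab show "\<exists>y\<in>carrier difference_ring. y \<oplus>\<^bsub>difference_ring\<^esub> x = \<zero>\<^bsub>difference_ring\<^esub>"
      using diff_in_difference_ring by blast
  qed (auto elim!: difference_ring_carrierE intro!: diff_in_difference_ring
      simp: difference_ring_simps a_ac)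
  show "monoid difference_ring"
    by (rule monoidI)
      (auto elim!: difference_ring_carrierE intro!: diff_in_difference_ring
        simp: difference_ring_simps l_distr r_distr m_assoc a_ac)
qed (auto elim!: difference_ring_carrierE simp: difference_ring_simps l_distr r_distr a_ac)

lemma carrier_subset_difference_ring: "carrier S \<subseteq> carrier difference_ring"
  using diff_in_difference_ring diff_zero by (metis subsetI zero_closed)

lemma difference_ring_restrict:
  assumes "x \<in> carrier S" "y \<in> carrier S"
  shows "x \<oplus>\<^bsub>difference_ring\<^esub> y = x \<oplus> y" "x \<otimes>\<^bsub>difference_ring\<^esub> y = x \<otimes> y"
  using difference_ring_add[of x \<zero> y \<zero>] difference_ring_mult[of x \<zero> y \<zero>] assms
  by (simp_all add: diff_zero)

section \<open>The order on the ring of differences\<close>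

definition difference_lt :: "('a \<times> 'a) set" where
  "difference_lt = {(x, y). x \<in> carrier difference_ring \<and> y \<in> carrier difference_ring \<and>
     y \<ominus>\<^bsub>difference_ring\<^esub> x \<in> carrier S - {\<zero>}}"

lemma difference_ring_zero_one:
  "\<zero>\<^bsub>difference_ring\<^esub> = \<zero>" "\<one>\<^bsub>difference_ring\<^esub> = \<one>"
  by (simp_all add: difference_ring_def)

lemma difference_ring_minus:
  assumes "a \<in> carrier S" "b \<in> carrier S"
  shows "\<ominus>\<^bsub>difference_ring\<^esub> diff a b = diff b a"
proof -
  interpret R: ring difference_ring by (rule ring_difference_ring)
  have "diff b a \<oplus>\<^bsub>difference_ring\<^esub> diff a b = \<zero>\<^bsub>difference_ring\<^esub>"
    using assms by (simp add: difference_ring_simps diff_eq_iff a_ac)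
  then show ?thesis
    using assms by (simp add: R.minus_equality diff_in_difference_ring)
qed

lemma difference_ring_sub_eq_iff:
  assumes "x \<in> carrier difference_ring" "y \<in> carrier difference_ring" "z \<in> carrier difference_ring"
  shows "y \<ominus>\<^bsub>difference_ring\<^esub> x = z \<longleftrightarrow> y = x \<oplus>\<^bsub>difference_ring\<^esub> z"
proof -
  interpret R: ring difference_ring by (rule ring_difference_ring)
  show ?thesis
    using assms by (metis R.a_comm a_minus_def R.add.inv_solve_right')
qed

text \<open>The conditions on the cone match the semiring axioms: closure under sums is
  \<open>add_eq_zeroD\<close>, closure under products is \<open>mult_eq_zeroD\<close>, and totality
  holds because \<open>diff a b\<close> or \<open>diff b a\<close> lies in the semiring.
  Discreteness is \<open>add_eq_oneD\<close>: an element strictly between \<open>\<zero>\<close> and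
  \<open>\<one>\<close> would split \<open>\<one>\<close> into two nonzero summands.\<close>

lemma discretely_ordered_difference_ring:
  "discretely_ordered_ring difference_ring difference_lt"
proof -
  interpret R: ring difference_ring by (rule ring_difference_ring)
  note [simp] = difference_ring_restrict difference_ring_zero_one
  show ?thesis
    unfolding difference_lt_def
  proof (rule R.discretely_ordered_ring_of_cone)
    fix x assume "x \<in> carrier difference_ring"
    then obtain a b where ab: "a \<in> carrier S" "b \<in> carrier S" "x = diff a b"
      by (rule difference_ring_carrierE)
    then have "diff a b \<in> carrier S \<or> diff b a \<in> carrier S"
      by (cases rule: diff_cases[OF ab(1,2)]) (auto simp: diff_add)
    moreover have "\<ominus>\<^bsub>difference_ring\<^esub> x = \<zero>\<^bsub>difference_ring\<^esub> \<Longrightarrow> x = \<zero>\<^bsub>difference_ring\<^esub>"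
      using \<open>x \<in> carrier difference_ring\<close> by (metis R.minus_minus R.minus_zero)
    ultimately show "x = \<zero>\<^bsub>difference_ring\<^esub> \<or> x \<in> carrier S - {\<zero>} \<or>
        \<ominus>\<^bsub>difference_ring\<^esub> x \<in> carrier S - {\<zero>}"
      using ab by (auto simp: difference_ring_minus)
  next
    fix x assume x: "x \<in> carrier S - {\<zero>}"
      and 1: "\<one>\<^bsub>difference_ring\<^esub> \<ominus>\<^bsub>difference_ring\<^esub> x \<in> carrier S - {\<zero>}"
    define y where "y = \<one>\<^bsub>difference_ring\<^esub> \<ominus>\<^bsub>difference_ring\<^esub> x"
    have y: "y \<in> carrier S" "y \<noteq> \<zero>"
      using 1 by (auto simp: y_def)
    have "x \<in> carrier difference_ring" "y \<in> carrier difference_ring"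
      using x y carrier_subset_difference_ring by auto
    then have "\<one> = x \<oplus> y"
      using difference_ring_sub_eq_iff[of x "\<one>\<^bsub>difference_ring\<^esub>" y] x y
      by (simp only: y_def[symmetric] R.one_closed refl True_implies_equals)
        (simp add: difference_ring_restrict difference_ring_zero_one)
    then show False
      using add_eq_oneD x y by (metis DiffE singletonI)
  qed (use carrier_subset_difference_ring one_neq_zero in \<open>auto dest: add_eq_zeroD mult_eq_zeroD\<close>)
qed

lemma nonneg_part_difference_ring: "nonneg_part difference_ring difference_lt = carrier S"
proof -
  interpret R: ring difference_ring by (rule ring_difference_ring)
  have "x \<ominus>\<^bsub>difference_ring\<^esub> \<zero>\<^bsub>difference_ring\<^esub> = x" if "x \<in> carrier difference_ring" for x
    using that by (simp add: difference_ring_sub_eq_iff)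
  then show ?thesis
    using carrier_subset_difference_ring
    by (auto simp: nonneg_part_def difference_lt_def difference_ring_zero_one)
qed

text \<open>Stated without subtraction, so that it has the same form as the description of the order
  of numerosities in \<open>order_iff_sum\<close>.\<close>

lemma difference_lt_iff:
  assumes "x \<in> carrier S" "y \<in> carrier S"
  shows "(x, y) \<in> difference_lt \<longleftrightarrow> (\<exists>z\<in>carrier S - {\<zero>}. x \<oplus> z = y)"
proof -
  have mem: "w \<in> carrier difference_ring" if "w \<in> carrier S" for w
    using that carrier_subset_difference_ring by blast
  have "y \<ominus>\<^bsub>difference_ring\<^esub> x = z \<longleftrightarrow> x \<oplus> z = y" if "z \<in> carrier S" for z
    using assms that by (auto simp: difference_ring_sub_eq_iff mem difference_ring_restrict)
  moreover have "(x, y) \<in> difference_lt \<longleftrightarrow>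
      (\<exists>z\<in>carrier S - {\<zero>}. y \<ominus>\<^bsub>difference_ring\<^esub> x = z)"
    using assms mem unfolding difference_lt_def by blast
  ultimately show ?thesis
    by auto
qed

end

section \<open>Numerosities\<close>

lemma pointsetsE:
  assumes "A \<in> pointsets"
  obtains k where "k \<ge> 1" "A \<subseteq> space_of_dim k"
  using assms by (auto simp: pointsets_def)

lemma pointsetsI: "\<lbrakk>k \<ge> 1; A \<subseteq> space_of_dim k\<rbrakk> \<Longrightarrow> A \<in> pointsets"
  by (auto simp: pointsets_def)

lemma pointsets_subset: "\<lbrakk>A \<in> pointsets; B \<subseteq> A\<rbrakk> \<Longrightarrow> B \<in> pointsets"
  by (auto simp: pointsets_def)

lemma empty_pointset: "{} \<in> pointsets"
  by (auto simp: pointsets_def)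

lemma singleton_pointset: "P \<in> points \<Longrightarrow> {P} \<in> pointsets"
  by (auto simp: pointsets_def points_def space_of_dim_def)

lemma prod_space_of_dim:
  "\<lbrakk>A \<subseteq> space_of_dim k; B \<subseteq> space_of_dim h\<rbrakk> \<Longrightarrow> A \<times>\<^sub>p B \<subseteq> space_of_dim (k + h)"
  by (auto simp: pointset_prod_def space_of_dim_def subset_iff)

lemma prod_pointset: "\<lbrakk>A \<in> pointsets; B \<in> pointsets\<rbrakk> \<Longrightarrow> A \<times>\<^sub>p B \<in> pointsets"
  by (metis pointsetsE pointsetsI prod_space_of_dim trans_le_add1)

lemma prod_assoc: "(A \<times>\<^sub>p B) \<times>\<^sub>p C = A \<times>\<^sub>p (B \<times>\<^sub>p C)"
  unfolding pointset_prod_def by (auto; metis append.assoc)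

lemma prod_Un_left: "(A \<union> B) \<times>\<^sub>p C = A \<times>\<^sub>p C \<union> B \<times>\<^sub>p C"
  and prod_Un_right: "C \<times>\<^sub>p (A \<union> B) = C \<times>\<^sub>p A \<union> C \<times>\<^sub>p B"
  by (auto simp: pointset_prod_def)

lemma prod_eq_empty_iff: "A \<times>\<^sub>p B = {} \<longleftrightarrow> A = {} \<or> B = {}"
  by (auto simp: pointset_prod_def)

text \<open>A concatenation splits uniquely once the length of one factor is known. Hence this lemma
  and the next one ask for a common dimension of \<open>A\<close> and \<open>B\<close>, and for
  nothing about \<open>C\<close>.\<close>

lemma prod_disjoint_left:
  "\<lbrakk>A \<subseteq> space_of_dim k; B \<subseteq> space_of_dim k; A \<inter> B = {}\<rbrakk> \<Longrightarrow> (A \<times>\<^sub>p C) \<inter> (B \<times>\<^sub>p C) = {}"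
  by (auto simp: pointset_prod_def space_of_dim_def subset_iff disjoint_iff)

lemma prod_disjoint_right:
  assumes "A \<subseteq> space_of_dim k" "B \<subseteq> space_of_dim k" "A \<inter> B = {}"
  shows "(C \<times>\<^sub>p A) \<inter> (C \<times>\<^sub>p B) = {}"
proof -
  have "p = p' \<and> q = q'" if "q \<in> A" "q' \<in> B" "p @ q = p' @ q'" for p q p' q'
  proof -
    have "length q = length q'"
      using that assms by (auto simp: space_of_dim_def)
    then show ?thesis
      using that by simp
  qed
  then show ?thesis
    using assms(3) unfolding pointset_prod_def by blast
qed

section \<open>Disjoint copies and unions\<close>

context equinumerosity
begin

lemma num_eq_iff:
  "\<lbrakk>A \<in> pointsets; B \<in> pointsets\<rbrakk> \<Longrightarrow> numerosity E A = numerosity E B \<longleftrightarrow> (A, B) \<in> E"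
  using eq_equiv_class_iff[OF equiv] by (simp add: numerosity_def)

lemma E_pointsets: "(A, B) \<in> E \<Longrightarrow> A \<in> pointsets \<and> B \<in> pointsets"
  using equiv by (auto simp: equiv_def)

lemma E_refl: "A \<in> pointsets \<Longrightarrow> (A, A) \<in> E"
  using equiv by (auto simp: equiv_def refl_on_def)

lemma E_sym: "(A, B) \<in> E \<Longrightarrow> (B, A) \<in> E"
  using equiv by (auto simp: equiv_def dest: symD)

lemma E_trans: "\<lbrakk>(A, B) \<in> E; (B, C) \<in> E\<rbrakk> \<Longrightarrow> (A, C) \<in> E"
  using equiv by (auto simp: equiv_def dest: transD)

lemma num_in: "A \<in> pointsets \<Longrightarrow> numerosity E A \<in> numerosities E"
  by (simp add: numerosity_def numerosities_def quotientI)

lemma numE: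
  assumes "x \<in> numerosities E"
  obtains A where "A \<in> pointsets" "x = numerosity E A"
  using assms by (auto simp: numerosity_def numerosities_def elim: quotientE)

text \<open>The prefix \<open>replicate (m - k) i\<close> does two things: its length raises the
  dimension to \<open>m\<close>, and its entries mark the copy by the first coordinate, so that
  copies with different tags are disjoint. The bound \<open>m > k\<close> keeps the prefix nonempty,
  hence a point. An inclusion in \<open>{i}\<close> is used because \<open>A\<close> may be
  empty.\<close>

lemma tagged_copy:
  assumes "A \<in> pointsets"
  obtains k where
    "\<And>m i. m > k \<Longrightarrow> \<exists>A'. A' \<subseteq> space_of_dim m \<and> hd ` A' \<subseteq> {i} \<and> numerosity E A' = numerosity E A"
proof -
  from assms obtain k where k: "k \<ge> 1" "A \<subseteq> space_of_dim k"
    by (rule pointsetsE)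
  have "\<exists>A'. A' \<subseteq> space_of_dim m \<and> hd ` A' \<subseteq> {i} \<and> numerosity E A' = numerosity E A"
    if "m > k" for m i
  proof (intro exI conjI)
    let ?P = "replicate (m - k) i"
    have P: "?P \<in> points"
      using that by (auto simp: points_def)
    show "{?P} \<times>\<^sub>p A \<subseteq> space_of_dim m"
      using that k by (auto simp: pointset_prod_def space_of_dim_def)
    show "hd ` ({?P} \<times>\<^sub>p A) \<subseteq> {i}"
      using that by (auto simp: pointset_prod_def hd_append)
    show "numerosity E ({?P} \<times>\<^sub>p A) = numerosity E A"
      using E3[OF assms P] num_eq_iff E_pointsets by blast
  qed
  then show thesis
    using that by blast
qed

lemma disjoint_copies3:
  assumes "x \<in> numerosities E" "y \<in> numerosities E" "z \<in> numerosities E"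
  obtains k A B C where "k \<ge> 1" "A \<subseteq> space_of_dim k" "B \<subseteq> space_of_dim k" "C \<subseteq> space_of_dim k"
    "A \<inter> B = {}" "A \<inter> C = {}" "B \<inter> C = {}"
    "x = numerosity E A" "y = numerosity E B" "z = numerosity E C"
proof -
  obtain A B C where ABC: "A \<in> pointsets" "B \<in> pointsets" "C \<in> pointsets"
    "x = numerosity E A" "y = numerosity E B" "z = numerosity E C"
    using assms by (metis numE)
  from ABC(1) obtain a where a: "\<And>m i. m > a \<Longrightarrow>
      \<exists>A'. A' \<subseteq> space_of_dim m \<and> hd ` A' \<subseteq> {i} \<and> numerosity E A' = numerosity E A"
    by (rule tagged_copy) blast
  from ABC(2) obtain b where b: "\<And>m i. m > b \<Longrightarrow>
      \<exists>A'. A' \<subseteq> space_of_dim m \<and> hd ` A' \<subseteq> {i} \<and> numerosity E A' = numerosity E B"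
    by (rule tagged_copy) blast
  from ABC(3) obtain c where c: "\<And>m i. m > c \<Longrightarrow>
      \<exists>A'. A' \<subseteq> space_of_dim m \<and> hd ` A' \<subseteq> {i} \<and> numerosity E A' = numerosity E C"
    by (rule tagged_copy) blast
  \<comment> \<open>A dimension above all three bounds; the tags 0, 1 and 2 then separate the
    copies.\<close>
  define m where "m = Suc (a + b + c)"
  obtain A' where A': "A' \<subseteq> space_of_dim m" "hd ` A' \<subseteq> {0}" "numerosity E A' = numerosity E A"
    using a[of m 0] by (auto simp: m_def)
  obtain B' where B': "B' \<subseteq> space_of_dim m" "hd ` B' \<subseteq> {1}" "numerosity E B' = numerosity E B"
    using b[of m 1] by (auto simp: m_def)
  obtain C' where C': "C' \<subseteq> space_of_dim m" "hd ` C' \<subseteq> {2}" "numerosity E C' = numerosity E C"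
    using c[of m 2] by (auto simp: m_def)
  have "A' \<inter> B' = {}" "A' \<inter> C' = {}" "B' \<inter> C' = {}"
    using A'(2) B'(2) C'(2) by fastforce+
  with A' B' C' ABC show thesis
    by (intro that[of m A' B' C']) (auto simp: m_def)
qed

lemma disjoint_copies:
  assumes "x \<in> numerosities E" "y \<in> numerosities E"
  obtains k A B where "k \<ge> 1" "A \<subseteq> space_of_dim k" "B \<subseteq> space_of_dim k" "A \<inter> B = {}"
    "x = numerosity E A" "y = numerosity E B"
  using disjoint_copies3[OF assms assms(2)] by metis

text \<open>Adding a set \<open>C\<close> disjoint from both sides changes neither
  \<open>A - B\<close> nor \<open>B - A\<close>, and by E1 these two differences decide
  equinumerosity.\<close>

lemma E_Un_cancel:
  assumes "k \<ge> 1" "A \<subseteq> space_of_dim k" "B \<subseteq> space_of_dim k" "C \<subseteq> space_of_dim k"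
    and "A \<inter> C = {}" "B \<inter> C = {}"
  shows "(A \<union> C, B \<union> C) \<in> E \<longleftrightarrow> (A, B) \<in> E"
proof -
  have "(A \<union> C) - (B \<union> C) = A - B" "(B \<union> C) - (A \<union> C) = B - A"
    using assms by auto
  moreover have "A \<union> C \<in> pointsets" "B \<union> C \<in> pointsets" "A \<in> pointsets" "B \<in> pointsets"
    using assms by (auto intro!: pointsetsI[of k])
  ultimately show ?thesis
    using E1 by metis
qed

(* Prefixing by points moves the two pairs into disjoint regions of a common dimension,
   where A and B can be exchanged for A' and B' one at a time. *)
lemma E_Un_cong:
  assumes k: "k \<ge> 1" "A \<subseteq> space_of_dim k" "B \<subseteq> space_of_dim k" "A \<inter> B = {}"
    and h: "h \<ge> 1" "A' \<subseteq> space_of_dim h" "B' \<subseteq> space_of_dim h" "A' \<inter> B' = {}"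
    and AA': "(A, A') \<in> E" and BB': "(B, B') \<in> E"
  shows "(A \<union> B, A' \<union> B') \<in> E"
proof -
  \<comment> \<open>The lengths are crossed: prefixing \<open>P\<close> to dimension
    \<open>k\<close> and \<open>Q\<close> to dimension \<open>h\<close> both lead to dimension
    \<open>Suc (h + k)\<close>, and the entries 0 and 1 keep the copies apart.\<close>
  define P where "P = replicate (Suc h) (0::nat)"
  define Q where "Q = replicate (Suc k) (1::nat)"
  have PQ: "P \<in> points" "Q \<in> points"
    by (auto simp: P_def Q_def points_def)
  have PE: "({P} \<times>\<^sub>p V, V) \<in> E" and QE: "({Q} \<times>\<^sub>p V, V) \<in> E" if "V \<in> pointsets" for V
    using E3[OF that] PQ by auto
  have dimP: "{P} \<times>\<^sub>p V \<subseteq> space_of_dim (Suc (h + k))" if "V \<subseteq> space_of_dim k" for V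
    using that by (auto simp: pointset_prod_def space_of_dim_def P_def)
  have dimQ: "{Q} \<times>\<^sub>p V \<subseteq> space_of_dim (Suc (h + k))" if "V \<subseteq> space_of_dim h" for V
    using that by (auto simp: pointset_prod_def space_of_dim_def Q_def)
  have disj: "({P} \<times>\<^sub>p V) \<inter> ({Q} \<times>\<^sub>p W) = {}" for V W
    by (auto simp: pointset_prod_def P_def Q_def)
  have pts: "A \<union> B \<in> pointsets" "A' \<union> B' \<in> pointsets" "A \<in> pointsets" "B \<in> pointsets"
      "A' \<in> pointsets" "B' \<in> pointsets"
    using k h by (auto intro: pointsetsI)
  have "({P} \<times>\<^sub>p A, {Q} \<times>\<^sub>p A') \<in> E" "({P} \<times>\<^sub>p B, {Q} \<times>\<^sub>p B') \<in> E"
    using PE QE AA' BB' pts E_sym E_trans by meson+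
  moreover have "({P} \<times>\<^sub>p A) \<inter> ({P} \<times>\<^sub>p B) = {}" "({Q} \<times>\<^sub>p A') \<inter> ({Q} \<times>\<^sub>p B') = {}"
    using prod_disjoint_right k h by blast+
  ultimately have "({P} \<times>\<^sub>p A \<union> {P} \<times>\<^sub>p B, {Q} \<times>\<^sub>p A' \<union> {P} \<times>\<^sub>p B) \<in> E"
    "({P} \<times>\<^sub>p B \<union> {Q} \<times>\<^sub>p A', {Q} \<times>\<^sub>p B' \<union> {Q} \<times>\<^sub>p A') \<in> E"
    using disj k h dimP dimQ
      E_Un_cancel[of "Suc (h + k)" "{P} \<times>\<^sub>p A" "{Q} \<times>\<^sub>p A'" "{P} \<times>\<^sub>p B"]
      E_Un_cancel[of "Suc (h + k)" "{P} \<times>\<^sub>p B" "{Q} \<times>\<^sub>p B'" "{Q} \<times>\<^sub>p A'"]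
    by (auto simp: Int_commute)
  then have "({P} \<times>\<^sub>p (A \<union> B), {Q} \<times>\<^sub>p (A' \<union> B')) \<in> E"
    unfolding prod_Un_right using E_trans by (metis Un_commute)
  then show ?thesis
    using PE[OF pts(1)] QE[OF pts(2)] E_sym E_trans by meson
qed

section \<open>Existence and uniqueness of the operations and the order\<close>

lemma ex1_numerosity_sum: "\<exists>!plusN. numerosity_sum E plusN"
proof (rule ex_ex1I)
  \<comment> \<open>This relation is single-valued by \<open>E_Un_cong\<close> and total by
    \<open>disjoint_copies\<close>. Totality also gives uniqueness of the sum: every pair of classes
    has representatives at which the value is prescribed, and extensionality fixes the rest.\<close>
  define rel where "rel x y z \<longleftrightarrow> (\<exists>k\<ge>1. \<exists>A B. A \<subseteq> space_of_dim k \<and> B \<subseteq> space_of_dim k \<and>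
    A \<inter> B = {} \<and> x = numerosity E A \<and> y = numerosity E B \<and> z = numerosity E (A \<union> B))" for x y z
  have rel_unique: "z = z'" if z: "rel x y z" and z': "rel x y z'" for x y z z'
  proof -
    obtain k A B where k: "k \<ge> 1" "A \<subseteq> space_of_dim k" "B \<subseteq> space_of_dim k" "A \<inter> B = {}"
      and AB: "x = numerosity E A" "y = numerosity E B" "z = numerosity E (A \<union> B)"
      using z unfolding rel_def by blast
    obtain h A' B' where h: "h \<ge> 1" "A' \<subseteq> space_of_dim h" "B' \<subseteq> space_of_dim h" "A' \<inter> B' = {}"
      and AB': "x = numerosity E A'" "y = numerosity E B'" "z' = numerosity E (A' \<union> B')"
      using z' unfolding rel_def by blast
    have "A \<in> pointsets" "B \<in> pointsets" "A \<union> B \<in> pointsets"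
      using k by (auto intro: pointsetsI)
    moreover have "A' \<in> pointsets" "B' \<in> pointsets" "A' \<union> B' \<in> pointsets"
      using h by (auto intro: pointsetsI)
    ultimately show ?thesis
      using E_Un_cong[OF k h] AB AB' num_eq_iff by metis
  qed
  define plusN where "plusN = (\<lambda>x\<in>numerosities E. \<lambda>y\<in>numerosities E. THE z. rel x y z)"
  have plusN: "plusN x y = z" if "x \<in> numerosities E" "y \<in> numerosities E" "rel x y z" for x y z
    using that the_equality[of "rel x y" z, OF that(3) rel_unique[OF _ that(3)]] by (simp add: plusN_def)
  have "plusN x y \<in> numerosities E" if xy: "x \<in> numerosities E" "y \<in> numerosities E" for x y
  proof -
    obtain k A B where k: "k \<ge> 1" "A \<subseteq> space_of_dim k" "B \<subseteq> space_of_dim k" "A \<inter> B = {}"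
      "x = numerosity E A" "y = numerosity E B"
      using disjoint_copies[OF xy] .
    then have "plusN x y = numerosity E (A \<union> B)"
      by (intro plusN xy) (auto simp: rel_def)
    also have "A \<union> B \<in> pointsets"
      using k by (auto intro: pointsetsI)
    then have "numerosity E (A \<union> B) \<in> numerosities E"
      by (rule num_in)
    finally show ?thesis .
  qed
  then have ext: "plusN \<in> numerosities E \<rightarrow>\<^sub>E (numerosities E \<rightarrow>\<^sub>E numerosities E)"
    by (auto simp: plusN_def)
  have num: "plusN (numerosity E A) (numerosity E B) = numerosity E (A \<union> B)"
    if "k \<ge> 1" "A \<subseteq> space_of_dim k" "B \<subseteq> space_of_dim k" "A \<inter> B = {}" for k A B
    using that by (intro plusN num_in) (auto simp: rel_def intro: pointsetsI)
  have "numerosity_sum E plusN"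
    unfolding numerosity_sum_def by (intro conjI allI impI) (fact ext, rule num)
  then show "\<exists>plusN. numerosity_sum E plusN"
    by (rule exI[of _ plusN])
next
  fix f g assume f: "numerosity_sum E f" and g: "numerosity_sum E g"
  have "f x y = g x y" if xy: "x \<in> numerosities E" "y \<in> numerosities E" for x y
    using disjoint_copies[OF xy] f g unfolding numerosity_sum_def by metis
  moreover have "f x \<in> extensional (numerosities E)" "g x \<in> extensional (numerosities E)"
    if "x \<in> numerosities E" for x
    using f g that by (auto simp: numerosity_sum_def PiE_def)
  ultimately have "f x = g x" if "x \<in> numerosities E" for x
    using that by (metis extensionalityI)
  moreover have "f \<in> extensional (numerosities E)" "g \<in> extensional (numerosities E)"
    using f g by (auto simp: numerosity_sum_def PiE_def)
  ultimately show "f = g"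
    by (metis extensionalityI)
qed

text \<open>Any two point sets can be multiplied directly, so no disjoint copies are needed and E4
  is exactly independence of the representatives.\<close>

lemma ex1_numerosity_product: "\<exists>!timesN. numerosity_product E timesN"
proof (rule ex_ex1I)
  define rel where "rel x y z \<longleftrightarrow> (\<exists>A\<in>pointsets. \<exists>B\<in>pointsets.
    x = numerosity E A \<and> y = numerosity E B \<and> z = numerosity E (A \<times>\<^sub>p B))" for x y z
  have rel_unique: "z = z'" if z: "rel x y z" and z': "rel x y z'" for x y z z'
    using z z' E4 prod_pointset num_eq_iff unfolding rel_def by metis
  define timesN where "timesN = (\<lambda>x\<in>numerosities E. \<lambda>y\<in>numerosities E. THE z. rel x y z)"
  have timesN: "timesN x y = z" if "x \<in> numerosities E" "y \<in> numerosities E" "rel x y z" for x y z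
    using that the_equality[of "rel x y" z, OF that(3) rel_unique[OF _ that(3)]] by (simp add: timesN_def)
  have num: "timesN (numerosity E A) (numerosity E B) = numerosity E (A \<times>\<^sub>p B)"
    if "A \<in> pointsets" "B \<in> pointsets" for A B
    using that by (intro timesN num_in) (auto simp: rel_def)
  then have "timesN x y \<in> numerosities E" if "x \<in> numerosities E" "y \<in> numerosities E" for x y
    using that prod_pointset num_in by (metis numE)
  then have ext: "timesN \<in> numerosities E \<rightarrow>\<^sub>E (numerosities E \<rightarrow>\<^sub>E numerosities E)"
    by (auto simp: timesN_def)
  have "numerosity_product E timesN"
    unfolding numerosity_product_def by (intro conjI ballI) (fact ext, rule num)
  then show "\<exists>timesN. numerosity_product E timesN"
    by (rule exI[of _ timesN])
next
  fix f g assume f: "numerosity_product E f" and g: "numerosity_product E g"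
  have "f x y = g x y" if "x \<in> numerosities E" "y \<in> numerosities E" for x y
    using that f g unfolding numerosity_product_def by (metis numE)
  moreover have "f x \<in> extensional (numerosities E)" "g x \<in> extensional (numerosities E)"
    if "x \<in> numerosities E" for x
    using f g that by (auto simp: numerosity_product_def PiE_def)
  ultimately have "f x = g x" if "x \<in> numerosities E" for x
    using that by (metis extensionalityI)
  moreover have "f \<in> extensional (numerosities E)" "g \<in> extensional (numerosities E)"
    using f g by (auto simp: numerosity_product_def PiE_def)
  ultimately show "f = g"
    by (metis extensionalityI)
qed

text \<open>Trichotomy is applied to \<open>A\<close> and \<open>C\<close>. Each of the other two
  alternatives, carried back along the equinumerosity of \<open>B\<close> and \<open>C\<close>,
  would hold for \<open>A\<close> and \<open>B\<close> together with the given proper part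
  \<open>B'\<close>, against exclusivity. This makes the order independent of the representative on
  the right.\<close>

lemma proper_part_cong:
  assumes "A \<in> pointsets" "B \<in> pointsets" "(B, C) \<in> E" "B' \<subset> B" "(A, B') \<in> E"
  shows "\<exists>C'. C' \<subset> C \<and> (A, C') \<in> E"
proof -
  have C: "C \<in> pointsets"
    using assms E_pointsets by blast
  have "(A, C) \<notin> E"
    using E2_not_ac[OF assms(1,2)] assms E_sym E_trans by meson
  moreover have "\<not> (\<exists>A'. A' \<subset> A \<and> (A', C) \<in> E)"
    using E2_not_bc[OF assms(1,2)] assms E_sym E_trans by meson
  ultimately show ?thesis
    using E2_some[OF assms(1) C] by blast
qed

lemma ex1_numerosity_order: "\<exists>!lessN. numerosity_order E lessN"
proof (rule ex_ex1I)
  define lessN where "lessN = {(numerosity E A, numerosity E B) | A B.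
    A \<in> pointsets \<and> B \<in> pointsets \<and> (\<exists>B'. B' \<subset> B \<and> (A, B') \<in> E)}"
  have num: "(numerosity E A, numerosity E B) \<in> lessN \<longleftrightarrow> (\<exists>B'. B' \<subset> B \<and> (A, B') \<in> E)"
    if AB: "A \<in> pointsets" "B \<in> pointsets" for A B
  proof
    assume "(numerosity E A, numerosity E B) \<in> lessN"
    then obtain C D D' where CD: "C \<in> pointsets" "D \<in> pointsets" "D' \<subset> D" "(C, D') \<in> E"
      "numerosity E A = numerosity E C" "numerosity E B = numerosity E D"
      unfolding lessN_def by blast
    then have "(D, B) \<in> E" "(A, D') \<in> E"
      using AB num_eq_iff E_sym E_trans by metis+
    then show "\<exists>B'. B' \<subset> B \<and> (A, B') \<in> E"
      by (intro proper_part_cong[OF AB(1) CD(2) _ CD(3)])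
  qed (use AB in \<open>auto simp: lessN_def\<close>)
  have sub: "lessN \<subseteq> numerosities E \<times> numerosities E"
    using num_in by (auto simp: lessN_def)
  have "trans lessN"
  proof (rule transI)
    fix x y z assume xy: "(x, y) \<in> lessN" and yz: "(y, z) \<in> lessN"
    then obtain A B C where ABC: "A \<in> pointsets" "B \<in> pointsets" "C \<in> pointsets"
      and x: "x = numerosity E A" and y: "y = numerosity E B" and z: "z = numerosity E C"
      using sub by (metis SigmaD1 SigmaD2 numE subsetD)
    obtain B' where B': "B' \<subset> B" "(A, B') \<in> E"
      using xy ABC num unfolding x y by auto
    obtain C' where C': "C' \<subset> C" "(B, C') \<in> E"
      using yz ABC num unfolding y z by auto
    \<comment> \<open>Since \<open>B\<close> is equinumerous with \<open>C'\<close>, the proper part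
      \<open>B'\<close> matching \<open>A\<close> is replaced by a proper part of \<open>C'\<close>,
      which lies properly inside \<open>C\<close>.\<close>
    obtain C'' where "C'' \<subset> C'" "(A, C'') \<in> E"
      using proper_part_cong[OF ABC(1,2) C'(2) B'] by blast
    with C' show "(x, z) \<in> lessN"
      unfolding x z using num[OF ABC(1,3)] by blast
  qed
  moreover have "irrefl lessN"
  proof (rule irreflI)
    fix x show "(x, x) \<notin> lessN"
    proof
      assume x: "(x, x) \<in> lessN"
      then obtain A where A: "A \<in> pointsets" "x = numerosity E A"
        using sub numE by blast
      then show False
        using x num E2_not_ac[of A A] E_refl by blast
    qed
  qed
  moreover have "total_on (numerosities E) lessN"
  proof (rule total_onI)
    fix x y assume "x \<in> numerosities E" "y \<in> numerosities E" and "x \<noteq> y"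
    then obtain A B where AB: "A \<in> pointsets" "B \<in> pointsets"
      and x: "x = numerosity E A" and y: "y = numerosity E B"
      by (metis numE)
    have "(A, B) \<notin> E"
      using \<open>x \<noteq> y\<close> AB x y num_eq_iff by blast
    then show "(x, y) \<in> lessN \<or> (y, x) \<in> lessN"
      using E2_some[OF AB] num AB E_sym unfolding x y by blast
  qed
  ultimately have "numerosity_order E lessN"
    unfolding numerosity_order_def strict_linear_order_on_def using num sub by blast
  then show "\<exists>lessN. numerosity_order E lessN"
    by (rule exI[of _ lessN])
next
  fix r s assume r: "numerosity_order E r" and s: "numerosity_order E s"
  have sub: "r \<subseteq> numerosities E \<times> numerosities E" "s \<subseteq> numerosities E \<times> numerosities E"
    using r s by (simp_all add: numerosity_order_def)
  have "(x, y) \<in> r \<longleftrightarrow> (x, y) \<in> s" if "x \<in> numerosities E" "y \<in> numerosities E" for x y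
    using that r s unfolding numerosity_order_def by (metis numE)
  then have "p \<in> r \<longleftrightarrow> p \<in> s" for p
    using sub by (cases p) (metis SigmaD1 SigmaD2 subsetD)
  then show "r = s"
    by blast
qed

text \<open>The singleton \<open>{P @ Q}\<close> arises both from \<open>{P}\<close> by appending
  the point \<open>Q\<close> and from \<open>{Q}\<close> by prefixing the point \<open>P\<close>, so
  E3 relates it to both.\<close>

lemma singletons_equinumerous:
  assumes P: "P \<in> points" and Q: "Q \<in> points"
  shows "({P}, {Q}) \<in> E"
proof -
  have "{P} \<times>\<^sub>p {Q} = {P @ Q}" "{Q} \<times>\<^sub>p {P} = {Q @ P}"
    by (auto simp: pointset_prod_def)
  then show ?thesis
    using E3[OF singleton_pointset[OF P] Q] E3[OF singleton_pointset[OF Q] P] E_sym E_trans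
    by metis
qed

text \<open>If a nonempty \<open>A\<close> were equinumerous with \<open>{}\<close>, then so would
  be its proper subset \<open>{}\<close>, which E2 excludes.\<close>

lemma equinumerous_empty_iff: "A \<in> pointsets \<Longrightarrow> (A, {}) \<in> E \<longleftrightarrow> A = {}"
  using E2_not_ab[of A "{}"] E_refl empty_pointset by blast

end

section \<open>The semiring of numerosities and its ring of differences\<close>

locale numerosity_structure = equinumerosity +
  fixes plusN timesN lessN
  assumes sum: "numerosity_sum E plusN"
    and product: "numerosity_product E timesN"
    and order: "numerosity_order E lessN"
begin

text \<open>By \<open>singletons_equinumerous\<close> every singleton of a point represents the
  unit; \<open>[0]\<close> is just one such point.\<close>

definition numerosity_semiring :: "nat list set set ring" where
  "numerosity_semiring = \<lparr>carrier = numerosities E, monoid.mult = timesN, one = numerosity E {[0]},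
     ring.zero = numerosity E {}, add = plusN\<rparr>"

lemma semiring_sel:
  "carrier numerosity_semiring = numerosities E" "monoid.mult numerosity_semiring = timesN"
  "one numerosity_semiring = numerosity E {[0]}" "ring.zero numerosity_semiring = numerosity E {}"
  "add numerosity_semiring = plusN"
  by (simp_all add: numerosity_semiring_def)

lemma sum_num:
  "\<lbrakk>k \<ge> 1; A \<subseteq> space_of_dim k; B \<subseteq> space_of_dim k; A \<inter> B = {}\<rbrakk> \<Longrightarrow>
    plusN (numerosity E A) (numerosity E B) = numerosity E (A \<union> B)"
  using sum unfolding numerosity_sum_def by blast

lemma product_num:
  "\<lbrakk>A \<in> pointsets; B \<in> pointsets\<rbrakk> \<Longrightarrow>
    timesN (numerosity E A) (numerosity E B) = numerosity E (A \<times>\<^sub>p B)"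
  using product unfolding numerosity_product_def by blast

lemma order_num:
  "\<lbrakk>A \<in> pointsets; B \<in> pointsets\<rbrakk> \<Longrightarrow>
    (numerosity E A, numerosity E B) \<in> lessN \<longleftrightarrow> (\<exists>B'. B' \<subset> B \<and> (A, B') \<in> E)"
  using order unfolding numerosity_order_def by blast

lemma sum_closed: "\<lbrakk>x \<in> numerosities E; y \<in> numerosities E\<rbrakk> \<Longrightarrow> plusN x y \<in> numerosities E"
  using sum unfolding numerosity_sum_def by (meson PiE_mem)

lemma product_closed: "\<lbrakk>x \<in> numerosities E; y \<in> numerosities E\<rbrakk> \<Longrightarrow> timesN x y \<in> numerosities E"
  using product unfolding numerosity_product_def by (meson PiE_mem)

lemma num_eq_zero_iff: "A \<in> pointsets \<Longrightarrow> numerosity E A = numerosity E {} \<longleftrightarrow> A = {}"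
  by (simp add: num_eq_iff empty_pointset equinumerous_empty_iff)

lemma origin_point: "[0] \<in> points"
  by (simp add: points_def)

text \<open>A proper part \<open>B'\<close> of \<open>B\<close> leaves the nonempty remainder
  \<open>B - B'\<close>, whose class is the missing summand. Conversely, disjoint representatives of
  \<open>x\<close> and of a nonzero \<open>z\<close> make the first a proper subset of the
  union.\<close>

lemma order_iff_sum:
  assumes xy: "x \<in> numerosities E" "y \<in> numerosities E"
  shows "(x, y) \<in> lessN \<longleftrightarrow> (\<exists>z\<in>numerosities E - {numerosity E {}}. plusN x z = y)"
proof
  assume "(x, y) \<in> lessN"
  obtain A where A: "A \<in> pointsets" "x = numerosity E A"
    using xy(1) by (rule numE)
  obtain B where B: "B \<in> pointsets" "y = numerosity E B"
    using xy(2) by (rule numE)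
  from \<open>(x, y) \<in> lessN\<close> obtain B' where B': "B' \<subset> B" "(A, B') \<in> E"
    using A B order_num by blast
  obtain k where k: "k \<ge> 1" "B \<subseteq> space_of_dim k"
    using B(1) by (rule pointsetsE)
  have "plusN (numerosity E B') (numerosity E (B - B')) = numerosity E (B' \<union> (B - B'))"
    using k B' by (intro sum_num[of k]) auto
  moreover have "B' \<union> (B - B') = B"
    using B' by auto
  moreover have "numerosity E B' = x"
    using A B B' num_eq_iff E_pointsets by blast
  moreover have "B - B' \<in> pointsets" "B - B' \<noteq> {}"
    using B B' pointsets_subset by auto
  ultimately show "\<exists>z\<in>numerosities E - {numerosity E {}}. plusN x z = y"
    using B num_in num_eq_zero_iff by (metis DiffI singletonD)
next
  assume "\<exists>z\<in>numerosities E - {numerosity E {}}. plusN x z = y"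
  then obtain z where z: "z \<in> numerosities E" "z \<noteq> numerosity E {}" "plusN x z = y"
    by blast
  obtain k A C where k: "k \<ge> 1" "A \<subseteq> space_of_dim k" "C \<subseteq> space_of_dim k" "A \<inter> C = {}"
    and AC: "x = numerosity E A" "z = numerosity E C"
    using disjoint_copies[OF xy(1) z(1)] .
  have pts: "A \<in> pointsets" "A \<union> C \<in> pointsets"
    using k by (auto intro: pointsetsI)
  have "C \<noteq> {}"
    using z AC by metis
  then have "A \<subset> A \<union> C"
    using k by auto
  then have "(numerosity E A, numerosity E (A \<union> C)) \<in> lessN"
    using order_num[OF pts] E_refl[OF pts(1)] by blast
  then show "(x, y) \<in> lessN"
    using z(3) AC sum_num[OF k] by simp
qed

lemma order_linear: "strict_linear_order_on (numerosities E) lessN"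
  using order by (simp add: numerosity_order_def)

lemma sum_zero: "x \<in> numerosities E \<Longrightarrow> plusN (numerosity E {}) x = x"
  by (metis Un_empty_left empty_subsetI inf_bot_left numE pointsetsE sum_num)

lemma sum_commute:
  assumes "x \<in> numerosities E" "y \<in> numerosities E"
  shows "plusN x y = plusN y x"
proof -
  obtain k A B where "k \<ge> 1" "A \<subseteq> space_of_dim k" "B \<subseteq> space_of_dim k" "A \<inter> B = {}"
    "x = numerosity E A" "y = numerosity E B"
    using disjoint_copies[OF assms] .
  then show ?thesis
    by (simp add: sum_num Un_commute Int_commute)
qed

lemma sum_zero_right: "x \<in> numerosities E \<Longrightarrow> plusN x (numerosity E {}) = x"
  by (metis empty_pointset num_in sum_commute sum_zero)

text \<open>Apart from the unit laws, which come from E3, the laws are set identities between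
  suitable representatives. Associativity of the sum needs three disjoint sets in one dimension, and
  distributivity is checked on both sides because products need not commute.\<close>

lemma semiring_numerosity: "semiring numerosity_semiring"
proof (intro semiring.intro semiring_axioms.intro)
  show "abelian_monoid numerosity_semiring"
  proof (rule abelian_monoidI; unfold semiring_sel)
    fix x y z assume "x \<in> numerosities E" "y \<in> numerosities E" "z \<in> numerosities E"
    then obtain k A B C where "k \<ge> 1"
      "A \<subseteq> space_of_dim k" "B \<subseteq> space_of_dim k" "C \<subseteq> space_of_dim k"
      "A \<inter> B = {}" "A \<inter> C = {}" "B \<inter> C = {}"
      "x = numerosity E A" "y = numerosity E B" "z = numerosity E C"
      using disjoint_copies3 by metis
    then show "plusN (plusN x y) z = plusN x (plusN y z)"
      by (simp add: sum_num Int_Un_distrib Int_Un_distrib2 Un_assoc)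
  qed (simp_all add: sum_closed num_in empty_pointset sum_zero sum_zero_right sum_commute)
next
  show "Group.monoid numerosity_semiring"
  proof (rule monoidI; unfold semiring_sel)
    show "numerosity E {[0]} \<in> numerosities E"
      by (simp add: num_in singleton_pointset origin_point)
    fix x assume "x \<in> numerosities E"
    then obtain A where A: "A \<in> pointsets" "x = numerosity E A"
      by (rule numE)
    have "({[0]} \<times>\<^sub>p A, A) \<in> E" "(A \<times>\<^sub>p {[0]}, A) \<in> E"
      using E3[OF A(1) origin_point] E_trans by blast+
    then show "timesN (numerosity E {[0]}) x = x" "timesN x (numerosity E {[0]}) = x"
      using A by (simp_all add: product_num num_eq_iff prod_pointset singleton_pointset origin_point)
  next
    fix x y z assume "x \<in> numerosities E" "y \<in> numerosities E" "z \<in> numerosities E"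
    then obtain A B C where "A \<in> pointsets" "B \<in> pointsets" "C \<in> pointsets"
      "x = numerosity E A" "y = numerosity E B" "z = numerosity E C"
      by (metis numE)
    then show "timesN (timesN x y) z = timesN x (timesN y z)"
      by (simp add: product_num prod_pointset prod_assoc)
  qed (rule product_closed)
next
  fix x y z assume "x \<in> carrier numerosity_semiring" "y \<in> carrier numerosity_semiring"
    "z \<in> carrier numerosity_semiring"
  then have xy: "x \<in> numerosities E" "y \<in> numerosities E" and z: "z \<in> numerosities E"
    by (simp_all add: semiring_sel)
  obtain k A B where k: "k \<ge> 1" "A \<subseteq> space_of_dim k" "B \<subseteq> space_of_dim k" "A \<inter> B = {}"
    and AB: "x = numerosity E A" "y = numerosity E B"
    using disjoint_copies[OF xy] .
  obtain C where C: "C \<in> pointsets" "z = numerosity E C"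
    using z by (rule numE)
  obtain h where h: "h \<ge> 1" "C \<subseteq> space_of_dim h"
    using C(1) by (rule pointsetsE)
  have pts: "A \<in> pointsets" "B \<in> pointsets" "A \<union> B \<in> pointsets"
    using k by (auto intro: pointsetsI)
  have "plusN (numerosity E (A \<times>\<^sub>p C)) (numerosity E (B \<times>\<^sub>p C)) = numerosity E (A \<times>\<^sub>p C \<union> B \<times>\<^sub>p C)"
    using k h by (intro sum_num[of "k + h"] prod_space_of_dim prod_disjoint_left) auto
  then show "(x \<oplus>\<^bsub>numerosity_semiring\<^esub> y) \<otimes>\<^bsub>numerosity_semiring\<^esub> z =
      x \<otimes>\<^bsub>numerosity_semiring\<^esub> z \<oplus>\<^bsub>numerosity_semiring\<^esub> y \<otimes>\<^bsub>numerosity_semiring\<^esub> z"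
    using pts by (simp add: semiring_sel AB C product_num sum_num[OF k] prod_Un_left)
  have "plusN (numerosity E (C \<times>\<^sub>p A)) (numerosity E (C \<times>\<^sub>p B)) = numerosity E (C \<times>\<^sub>p A \<union> C \<times>\<^sub>p B)"
    using k h by (intro sum_num[of "h + k"] prod_space_of_dim prod_disjoint_right) auto
  then show "z \<otimes>\<^bsub>numerosity_semiring\<^esub> (x \<oplus>\<^bsub>numerosity_semiring\<^esub> y) =
      z \<otimes>\<^bsub>numerosity_semiring\<^esub> x \<oplus>\<^bsub>numerosity_semiring\<^esub> z \<otimes>\<^bsub>numerosity_semiring\<^esub> y"
    using pts by (simp add: semiring_sel AB C product_num sum_num[OF k] prod_Un_right)
next
  fix x assume "x \<in> carrier numerosity_semiring"
  then obtain A where A: "A \<in> pointsets" "x = numerosity E A"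
    by (auto simp: semiring_sel elim: numE)
  have "{} \<times>\<^sub>p A = {}" "A \<times>\<^sub>p {} = {}"
    by (simp_all add: prod_eq_empty_iff)
  with A show "\<zero>\<^bsub>numerosity_semiring\<^esub> \<otimes>\<^bsub>numerosity_semiring\<^esub> x = \<zero>\<^bsub>numerosity_semiring\<^esub>"
    "x \<otimes>\<^bsub>numerosity_semiring\<^esub> \<zero>\<^bsub>numerosity_semiring\<^esub> = \<zero>\<^bsub>numerosity_semiring\<^esub>"
    by (simp_all add: semiring_sel product_num empty_pointset)
qed

text \<open>The empty list has length 0 and is not a point, so \<open>{[]}\<close> is no point set
  and belongs to no class. It can thus serve as a tag: inserting it into a class is injective and
  never yields a class.\<close>

lemma Nil_set_notin_numerosity: "x \<in> numerosities E \<Longrightarrow> {[]} \<notin> x"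
  using E_pointsets
  by (fastforce elim: numE simp: numerosity_def pointsets_def space_of_dim_def)

lemma difference_semiring_numerosity: "difference_semiring numerosity_semiring (insert {[]})"
proof (intro difference_semiring.intro difference_semiring_axioms.intro semiring_numerosity;
    unfold semiring_sel)
  fix x y z assume xyz: "x \<in> numerosities E" "y \<in> numerosities E" "z \<in> numerosities E"
    and eq: "plusN x z = plusN y z"
  obtain k A B C where k: "k \<ge> 1"
    "A \<subseteq> space_of_dim k" "B \<subseteq> space_of_dim k" "C \<subseteq> space_of_dim k"
    "A \<inter> B = {}" "A \<inter> C = {}" "B \<inter> C = {}"
    and ABC: "x = numerosity E A" "y = numerosity E B" "z = numerosity E C"
    using disjoint_copies3[OF xyz] .
  have pts: "A \<in> pointsets" "B \<in> pointsets" "A \<union> C \<in> pointsets" "B \<union> C \<in> pointsets"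
    using k by (auto intro: pointsetsI)
  have "numerosity E (A \<union> C) = numerosity E (B \<union> C)"
    using eq k unfolding ABC by (simp add: sum_num)
  then have "(A, B) \<in> E"
    using E_Un_cancel[of k A B C] k pts by (simp add: num_eq_iff)
  then show "x = y"
    using pts ABC by (simp add: num_eq_iff)
next
  fix x y assume xy: "x \<in> numerosities E" "y \<in> numerosities E"
    and eq: "plusN x y = numerosity E {}"
  obtain k A B where k: "k \<ge> 1" "A \<subseteq> space_of_dim k" "B \<subseteq> space_of_dim k" "A \<inter> B = {}"
    and AB: "x = numerosity E A" "y = numerosity E B"
    using disjoint_copies[OF xy] .
  have "A \<union> B \<in> pointsets"
    using k by (auto intro: pointsetsI)
  then have "A \<union> B = {}"
    using eq k AB by (simp add: sum_num num_eq_zero_iff)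
  then show "x = numerosity E {}"
    using AB by simp
next
  fix x y assume xy: "x \<in> numerosities E" "y \<in> numerosities E"
  then have "x = y \<or> (x, y) \<in> lessN \<or> (y, x) \<in> lessN"
    using order_linear by (auto simp: strict_linear_order_on_def total_on_def)
  moreover have "plusN x (numerosity E {}) = x"
    using xy by (simp add: sum_zero_right)
  ultimately show "\<exists>z\<in>numerosities E. plusN x z = y \<or> plusN y z = x"
    using xy order_iff_sum num_in[OF empty_pointset] by (metis DiffD1)
next
  fix x y assume "x \<in> numerosities E" "y \<in> numerosities E"
    and eq: "timesN x y = numerosity E {}"
  then obtain A B where AB: "A \<in> pointsets" "B \<in> pointsets" "x = numerosity E A" "y = numerosity E B"
    by (metis numE)
  then show "x = numerosity E {} \<or> y = numerosity E {}"
    using eq by (auto simp: product_num num_eq_zero_iff prod_pointset prod_eq_empty_iff)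
next
  fix x y assume xy: "x \<in> numerosities E" "y \<in> numerosities E"
    and eq: "plusN x y = numerosity E {[0]}"
  obtain A where A: "A \<in> pointsets" "x = numerosity E A"
    using xy(1) by (rule numE)
  have one: "{[0]} \<in> pointsets"
    by (simp add: singleton_pointset origin_point)
  \<comment> \<open>A nonzero \<open>y\<close> puts \<open>x\<close> strictly below the class of
    \<open>{[0]}\<close>, so \<open>A\<close> is equinumerous with a proper subset of a singleton,
    which can only be empty.\<close>
  have "x = numerosity E {}" if "y \<noteq> numerosity E {}"
  proof -
    have "(numerosity E A, numerosity E {[0]}) \<in> lessN"
      using order_iff_sum[OF xy(1) num_in[OF one]] that xy eq A by blast
    then obtain B where "B \<subset> {[0]}" "(A, B) \<in> E"
      using order_num[OF A(1) one] by blast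
    then have "(A, {}) \<in> E"
      by (auto simp: psubset_eq subset_singleton_iff)
    then show ?thesis
      using A by (simp add: num_eq_iff empty_pointset)
  qed
  then show "x = numerosity E {} \<or> y = numerosity E {}"
    by blast
next
  show "numerosity E {[0]} \<noteq> numerosity E {}"
    by (simp add: num_eq_zero_iff singleton_pointset origin_point)
  show "inj_on (insert {[]}) (numerosities E)"
    using Nil_set_notin_numerosity by (meson inj_onI insert_ident)
  show "insert {[]} x \<notin> numerosities E" for x
    using Nil_set_notin_numerosity by blast
qed

lemma numerosity_ring:
  "\<exists>(R :: nat list set set ring) lt. discretely_ordered_ring R lt \<and>
     is_nonneg_part (numerosities E) plusN timesN lessN R lt \<and>
     (\<exists>\<iota> \<in> ring_iso \<Z> (fundamental_subring R).
        \<forall>A\<in>pointsets. finite A \<longrightarrow> numerosity E A = \<iota> (int (card A)))"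
proof -
  interpret S: difference_semiring numerosity_semiring "insert {[]}"
    by (rule difference_semiring_numerosity)
  let ?R = "S.difference_ring"
  interpret R: discretely_ordered_ring ?R S.difference_lt
    by (rule S.discretely_ordered_difference_ring)
  \<comment> \<open>Both orders are described by the existence of a nonzero summand, so they agree
    on numerosities.\<close>
  have nonneg: "is_nonneg_part (numerosities E) plusN timesN lessN ?R S.difference_lt"
    unfolding is_nonneg_part_def S.nonneg_part_difference_ring
    using S.difference_ring_restrict S.difference_lt_iff order_iff_sum
    by (simp add: semiring_sel)
  \<comment> \<open>Each new point adds a disjoint singleton, whose class is the unit of the ring,
    so the class of a finite set counts its points.\<close>
  have card: "numerosity E A = [int (card A)] \<cdot>\<^bsub>?R\<^esub> \<one>\<^bsub>?R\<^esub>" if "finite A" "A \<in> pointsets" for A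
    using that
  proof (induction A rule: finite_induct)
    case empty
    then show ?case
      by (simp add: add_pow_int_ge S.difference_ring_zero_one semiring_sel)
  next
    case (insert p A)
    have pts: "A \<in> pointsets" "{p} \<in> pointsets"
      using insert.prems pointsets_subset by blast+
    obtain k where k: "k \<ge> 1" "insert p A \<subseteq> space_of_dim k"
      using insert.prems by (rule pointsetsE)
    have "p \<in> points"
      using k by (auto simp: points_def space_of_dim_def)
    then have "numerosity E {p} = \<one>\<^bsub>?R\<^esub>"
      using singletons_equinumerous origin_point pts
      by (simp add: S.difference_ring_zero_one semiring_sel num_eq_iff singleton_pointset)
    moreover have "plusN (numerosity E A) (numerosity E {p}) = numerosity E (A \<union> {p})"
      using k insert.hyps by (intro sum_num[of k]) auto
    then have "numerosity E A \<oplus>\<^bsub>?R\<^esub> numerosity E {p} = numerosity E (insert p A)"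
      using S.difference_ring_restrict(1) num_in pts by (simp add: semiring_sel)
    ultimately show ?case
      using insert.IH pts insert.hyps by (simp add: semiring_sel add_pow_int_ge nat_add_distrib)
  qed
  show ?thesis
    using R.discretely_ordered_ring_axioms nonneg R.int_multiple_one_ring_iso card
    by (intro exI[of _ ?R] exI[of _ S.difference_lt] conjI
        bexI[of _ "\<lambda>k::int. [k] \<cdot>\<^bsub>?R\<^esub> \<one>\<^bsub>?R\<^esub>"]) simp_all
qed

end

theorem theorem4p2:
  fixes E :: "(nat list set \<times> nat list set) set"
  assumes "equinumerosity E"
  shows "(\<exists>!plusN. numerosity_sum E plusN) \<and>
    (\<exists>!timesN. numerosity_product E timesN) \<and>
    (\<exists>!lessN. numerosity_order E lessN) \<and>
    (\<forall>plusN timesN lessN.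
       numerosity_sum E plusN \<longrightarrow> numerosity_product E timesN \<longrightarrow> numerosity_order E lessN \<longrightarrow>
       (\<exists>(R :: nat list set set ring) lt.
          discretely_ordered_ring R lt \<and>
          is_nonneg_part (numerosities E) plusN timesN lessN R lt \<and>
          (\<exists>\<iota> \<in> ring_iso \<Z> (fundamental_subring R).
             \<forall>A\<in>pointsets. finite A \<longrightarrow> numerosity E A = \<iota> (int (card A)))))"
proof -
  interpret equinumerosity E by fact
  show ?thesis
    using ex1_numerosity_sum ex1_numerosity_product ex1_numerosity_order
      numerosity_structure.numerosity_ring[OF numerosity_structure.intro[OF assms
          numerosity_structure_axioms.intro]]
    by (intro conjI allI impI)
qed

end
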